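(* Let $b\in\mathbb{R}^n$ and let $T\in\mathbb{R}^{n\times n}$ be a nonsingular matrix. Assume that $\|T^{-1}\|<1$. Then, for any starting point $x^0\in\mathbb{R}^n$, the semi-smooth Newton sequence $\{x^k\}$ given by $$[P(x^k)+T]\,x^{k+1}=b,\qquad k=0,1,\ldots,$$ is well-defined. Additionally, if $\|T^{-1}\|<1/2$, then (for any starting point $x^0\in\mathbb{R}^n$) $\{x^k\}$ converges $Q$-linearly to $x^*\in\mathbb{R}^n$, the unique solution of the equation $x^+ + Tx=b$, as follows: $$\|x^*-x^{k+1}\|\le \frac{\|T^{-1}\|}{1-\|T^{-1}\|}\,\|x^*-x^k\|,\qquad k=0,1,\ldots.$$
   Context: For $x\in\mathbb{R}^n$, $x^+$ is the vector with $i$-th component $\max\{x_i,0\}$. $\mathrm{sgn}(x)$ is the vector whose $i$-th component is $1$, $0$ or $-1$ according to whether $x_i$ is positive, zero or negative. $\mathrm{diag}(x)$ is the diagonal matrix with $(i,i)$-th entry $x_i$, and $P(x):=\mathrm{diag}(\mathrm{sgn}(x^+))$. $\|\cdot\|$ is the Euclidean norm on $\mathbb{R}^n$ and, for a matrix $M$, $\|M\|:=\max\{\|Mx\| : x\in\mathbb{R}^n,\ \|x\|=1\}$. "Well-defined" means that at each step the linear system for $x^{k+1}$ has exactly one solution, i.e. $P(x^k)+T$ is nonsingular. $Q$-linear convergence to $x^*$ means that $x^k\to x^*$ and there is a constant $r\in[0,1)$ with $\|x^*-x^{k+1}\|\le r\|x^*-x^k\|$ for all (sufficiently large) $k$. 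*)

theory Defs
  imports "HOL-Analysis.Analysis"
begin

definition pos_part :: "real ^ 'n \<Rightarrow> real ^ 'n" where
  "pos_part x = (\<chi> i. max (x $ i) 0)"

text \<open>The library's \<^const>\<open>sgn\<close> on vectors is normalisation \<open>x /\<^sub>R norm x\<close>; here the sign
  is taken componentwise.\<close>

definition sgn_vec :: "real ^ 'n \<Rightarrow> real ^ 'n" where
  "sgn_vec x = (\<chi> i. sgn (x $ i))"

definition diag_mat :: "real ^ 'n \<Rightarrow> real ^ 'n ^ 'n" where
  "diag_mat x = (\<chi> i j. if i = j then x $ i else 0)"

definition P :: "real ^ 'n \<Rightarrow> real ^ 'n ^ 'n" where
  "P x = diag_mat (sgn_vec (pos_part x))"

abbreviation mat_norm :: "real ^ 'n ^ 'm \<Rightarrow> real" where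
  "mat_norm A \<equiv> onorm ((*v) A)"

text \<open>The operator norm is the maximum of \<open>norm (A *v x)\<close> over the unit sphere.\<close>

lemma mat_norm_is_max:
  fixes A :: "real ^ 'n ^ 'm"
  shows "mat_norm A \<in> {norm (A *v x) |x. norm x = 1}"
    and "s \<in> {norm (A *v x) |x. norm x = 1} \<Longrightarrow> s \<le> mat_norm A"
proof -
  have bl: "bounded_linear ((*v) A)"
    by (rule matrix_vector_mul_bounded_linear)
  have ub: "norm (A *v x) \<le> mat_norm A" if "norm x = 1" for x
    using onorm[OF bl, of x] that by simp
  then show "s \<in> {norm (A *v x) |x. norm x = 1} \<Longrightarrow> s \<le> mat_norm A"
    by auto
  let ?S = "sphere (0 :: real ^ 'n) 1"
  have "continuous_on ?S (\<lambda>x. norm (A *v x))"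
    by (intro continuous_intros linear_continuous_on bl)
  moreover have "?S \<noteq> {}"
    by simp
  ultimately obtain u where u: "u \<in> ?S" "\<And>y. y \<in> ?S \<Longrightarrow> norm (A *v y) \<le> norm (A *v u)"
    using continuous_attains_sup[of ?S "\<lambda>x. norm (A *v x)"] by auto
  have "norm (A *v x) \<le> norm (A *v u) * norm x" for x
  proof (cases "x = 0")
    case False
    have "norm (A *v (x /\<^sub>R norm x)) \<le> norm (A *v u)"
      using False by (intro u(2)) simp
    then show ?thesis
      using False by (simp add: matrix_vector_mult_scaleR field_simps)
  qed simp
  then have "mat_norm A \<le> norm (A *v u)"
    by (intro onorm_le)
  moreover have "norm u = 1"
    using u(1) by simp
  ultimately have "mat_norm A = norm (A *v u)"
    using ub[of u] by simp
  then show "mat_norm A \<in> {norm (A *v x) |x. norm x = 1}"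
    using \<open>norm u = 1\<close> by blast
qed

definition newton_seq ::
    "real ^ 'n ^ 'n \<Rightarrow> real ^ 'n \<Rightarrow> real ^ 'n \<Rightarrow> (nat \<Rightarrow> real ^ 'n) \<Rightarrow> bool" where
  "newton_seq T b x0 x \<longleftrightarrow> x 0 = x0 \<and> (\<forall>k. (P (x k) + T) *v x (Suc k) = b)"

text \<open>The first conjunct rules out vacuity of the second: an iteration that gets stuck at an
  unsolvable system has no infinite \<open>newton_seq\<close>.\<close>

definition newton_well_defined :: "real ^ 'n ^ 'n \<Rightarrow> real ^ 'n \<Rightarrow> real ^ 'n \<Rightarrow> bool" where
  "newton_well_defined T b x0 \<longleftrightarrow>
     (\<exists>!x. newton_seq T b x0 x) \<and>
     (\<forall>x. newton_seq T b x0 x \<longrightarrow>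
        (\<forall>k. invertible (P (x k) + T) \<and> (\<exists>!y. (P (x k) + T) *v y = b)))"

definition converges_Q_linearly :: "(nat \<Rightarrow> 'a :: real_normed_vector) \<Rightarrow> 'a \<Rightarrow> bool" where
  "converges_Q_linearly x l \<longleftrightarrow>
     x \<longlonglongrightarrow> l \<and>
     (\<exists>r. 0 \<le> r \<and> r < 1 \<and>
        (\<forall>\<^sub>F k in sequentially. norm (l - x (Suc k)) \<le> r * norm (l - x k)))"

end

theory Submission
  imports Defs
begin

text \<open>
  Everything rests on the bound \<open>norm y \<le> c * norm (T *v y)\<close> with \<open>c = mat_norm (matrix_inv T)\<close>.
  Since \<open>P x\<close> is a contraction, it makes the kernel of \<open>P x + T\<close> trivial when \<open>c < 1\<close>, and since
  the positive part is 1-Lipschitz, \<open>y \<mapsto> T\<inverse> (b - y\<^sup>+)\<close> has a unique fixed point by Banach's theorem.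
  For the rate, the error \<open>e = x\<^sup>* - x\<^sup>k\<^sup>+\<^sup>1\<close> satisfies \<open>T e = (P (x\<^sup>k) x\<^sup>* - (x\<^sup>*)\<^sup>+) - P (x\<^sup>k) e\<close>, where
  the term in parentheses is componentwise bounded by \<open>x\<^sup>* - x\<^sup>k\<close>; hence
  \<open>norm e \<le> c * (norm (x\<^sup>* - x\<^sup>k) + norm e)\<close>.
\<close>

lemma P_mult_nth: "(P x *v y) $ i = (if x $ i > 0 then y $ i else 0)"
proof -
  have "(P x *v y) $ i = (\<Sum>j\<in>UNIV. if i = j then sgn (max (x $ i) 0) * y $ j else 0)"
    unfolding P_def diag_mat_def sgn_vec_def pos_part_def matrix_vector_mult_def
    by (intro trans[OF vec_lambda_beta] sum.cong) auto
  then show ?thesis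
    by simp
qed

lemma norm_P_mult_le: "norm (P x *v y) \<le> norm y"
  by (rule norm_le_componentwise_cart) (simp add: P_mult_nth)

lemma norm_pos_part_diff_le: "norm (pos_part x - pos_part y) \<le> norm (x - y)"
  by (rule norm_le_componentwise_cart) (auto simp: pos_part_def)

text \<open>A component of the difference is nonzero only if 0 separates \<open>x $ i\<close> from
  \<open>y $ i\<close>. It then equals \<open>y $ i\<close> up to sign, which is at most the
  distance between the two.\<close>

lemma norm_P_mult_diff_pos_part_le: "norm (P x *v y - pos_part y) \<le> norm (y - x)"
  by (rule norm_le_componentwise_cart) (auto simp: pos_part_def P_mult_nth)

lemma matrix_inv_mult_cancel:
  fixes T :: "real ^ 'n ^ 'n"
  assumes "invertible T"
  shows "matrix_inv T *v (T *v y) = y" "T *v (matrix_inv T *v y) = y"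
proof -
  have "T ** matrix_inv T = mat 1 \<and> matrix_inv T ** T = mat 1"
    using assms unfolding invertible_def matrix_inv_def by (rule someI_ex)
  then show "matrix_inv T *v (T *v y) = y" "T *v (matrix_inv T *v y) = y"
    by (simp_all add: matrix_vector_mul_assoc)
qed

text \<open>This is the operator norm bound applied to
  \<open>y = matrix_inv T *v (T *v y)\<close>.\<close>

lemma norm_le_mat_norm_inv:
  fixes T :: "real ^ 'n ^ 'n"
  assumes "invertible T"
  shows "norm y \<le> mat_norm (matrix_inv T) * norm (T *v y)"
  using onorm[OF matrix_vector_mul_bounded_linear, of "matrix_inv T" "T *v y"]
  by (simp add: matrix_inv_mult_cancel[OF assms])

lemma mat_norm_nonneg: "0 \<le> mat_norm A"
  by (rule onorm_pos_le[OF matrix_vector_mul_bounded_linear])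

lemma invertible_P_add:
  fixes T :: "real ^ 'n ^ 'n"
  assumes "invertible T" and "mat_norm (matrix_inv T) < 1"
  shows "invertible (P x + T)"
proof -
  have "y = 0" if "(P x + T) *v y = 0" for y
  proof (rule ccontr)
    assume "y \<noteq> 0"
    have "T *v y = - (P x *v y)"
      using that by (simp add: matrix_vector_mult_add_rdistrib eq_neg_iff_add_eq_0 add.commute)
    then have "norm y \<le> mat_norm (matrix_inv T) * norm (P x *v y)"
      using norm_le_mat_norm_inv[OF assms(1), of y] by simp
    also have "\<dots> \<le> mat_norm (matrix_inv T) * norm y"
      by (intro mult_left_mono norm_P_mult_le mat_norm_nonneg)
    finally show False
      using assms(2) \<open>y \<noteq> 0\<close> by simp
  qed
  then show ?thesis
    by (auto simp: invertible_left_inverse matrix_left_invertible_ker)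
qed

lemma invertible_ex1_solution:
  fixes A :: "real ^ 'n ^ 'n"
  assumes "invertible A"
  shows "\<exists>!y. A *v y = b"
proof
  show "A *v (matrix_inv A *v b) = b"
    by (rule matrix_inv_mult_cancel(2)[OF assms])
  show "y = matrix_inv A *v b" if "A *v y = b" for y
    using matrix_inv_mult_cancel(1)[OF assms, of y] that by simp
qed

text \<open>Invertibility at every point, not merely along one orbit, turns the implicit system into
  an explicit recursion, which has exactly one orbit from \<open>x0\<close>.\<close>

lemma newton_well_definedI:
  fixes T :: "real ^ 'n ^ 'n"
  assumes "\<And>x. invertible (P x + T)"
  shows "newton_well_defined T b x0"
proof -
  have step: "(P u + T) *v v = b \<longleftrightarrow> v = matrix_inv (P u + T) *v b" for u v
    using matrix_inv_mult_cancel[OF assms] by metis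
  have "newton_seq T b x0 x \<longleftrightarrow> x = rec_nat x0 (\<lambda>_ u. matrix_inv (P u + T) *v b)" for x
  proof
    assume "newton_seq T b x0 x"
    then have "x 0 = x0" "x (Suc k) = matrix_inv (P (x k) + T) *v b" for k
      by (simp_all add: newton_seq_def step)
    then show "x = rec_nat x0 (\<lambda>_ u. matrix_inv (P u + T) *v b)"
      by (intro ext, rename_tac k, induct_tac k) auto
  qed (simp add: newton_seq_def step)
  then have "\<exists>!x. newton_seq T b x0 x"
    by simp
  then show ?thesis
    using assms invertible_ex1_solution[OF assms] by (simp add: newton_well_defined_def)
qed

lemma ex1_pos_part_equation:
  fixes T :: "real ^ 'n ^ 'n"
  assumes "invertible T" and "mat_norm (matrix_inv T) < 1"
  shows "\<exists>!y. pos_part y + T *v y = b"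
proof -
  define F where "F y = matrix_inv T *v (b - pos_part y)" for y
  have "dist (F x) (F y) \<le> mat_norm (matrix_inv T) * dist x y" for x y
  proof -
    have "F x - F y = matrix_inv T *v (pos_part y - pos_part x)"
      by (simp add: F_def matrix_vector_mult_diff_distrib)
    then have "dist (F x) (F y) \<le> mat_norm (matrix_inv T) * norm (pos_part y - pos_part x)"
      by (simp add: dist_norm onorm[OF matrix_vector_mul_bounded_linear])
    also have "\<dots> \<le> mat_norm (matrix_inv T) * norm (y - x)"
      by (intro mult_left_mono norm_pos_part_diff_le mat_norm_nonneg)
    finally show ?thesis
      by (simp add: dist_norm norm_minus_commute)
  qed
  then have "\<exists>!y. F y = y"
    using banach_fix_type[OF mat_norm_nonneg assms(2), of F] by blast
  moreover have "F y = y \<longleftrightarrow> pos_part y + T *v y = b" for y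
  proof -
    \<comment> \<open>Multiplying by \<open>T\<close> or by its inverse passes between the two
      equations.\<close>
    have "F y = y \<longleftrightarrow> b - pos_part y = T *v y"
      unfolding F_def using matrix_inv_mult_cancel[OF assms(1)] by metis
    then show ?thesis
      by (auto simp: algebra_simps)
  qed
  ultimately show ?thesis
    by simp
qed

text \<open>One step from an arbitrary \<open>u\<close> is considered, so no induction along the
  sequence is needed. The factor need not be below 1 here.\<close>

lemma newton_error_le:
  fixes T :: "real ^ 'n ^ 'n"
  assumes "invertible T" and "mat_norm (matrix_inv T) < 1"
    and sol: "pos_part y + T *v y = b"
    and step: "(P u + T) *v v = b"
  shows "norm (y - v) \<le> mat_norm (matrix_inv T) / (1 - mat_norm (matrix_inv T)) * norm (y - u)"
proof -
  let ?c = "mat_norm (matrix_inv T)"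
  have "pos_part y + T *v y = P u *v v + T *v v"
    using sol step by (simp add: matrix_vector_mult_add_rdistrib)
  \<comment> \<open>Writing \<open>v = y - (y - v)\<close> in \<open>P u *v v\<close> isolates the
    linearisation error at \<open>y\<close>.\<close>
  then have "T *v (y - v) = (P u *v y - pos_part y) - P u *v (y - v)"
    by (simp add: matrix_vector_mult_diff_distrib algebra_simps)
  then have "norm (T *v (y - v)) \<le> norm (P u *v y - pos_part y) + norm (P u *v (y - v))"
    by (metis norm_triangle_ineq4)
  also have "\<dots> \<le> norm (y - u) + norm (y - v)"
    by (intro add_mono norm_P_mult_diff_pos_part_le norm_P_mult_le)
  finally have "?c * norm (T *v (y - v)) \<le> ?c * (norm (y - u) + norm (y - v))"
    by (intro mult_left_mono mat_norm_nonneg)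
  then have "norm (y - v) \<le> ?c * (norm (y - u) + norm (y - v))"
    using norm_le_mat_norm_inv[OF assms(1), of "y - v"] by linarith
  \<comment> \<open>The error also occurs on the right with coefficient \<open>?c < 1\<close>;
    absorbing it on the left produces the denominator \<open>1 - ?c\<close>.\<close>
  then show ?thesis
    using assms(2) by (simp add: field_simps)
qed

text \<open>Iterating the contraction estimate gives a geometric bound on the error, so convergence
  itself follows from the rate.\<close>

lemma converges_Q_linearlyI:
  assumes "0 \<le> r" "r < 1" and step: "\<And>k. norm (l - x (Suc k)) \<le> r * norm (l - x k)"
  shows "converges_Q_linearly x l"
proof -
  have bound: "norm (x k - l) \<le> r ^ k * norm (l - x 0)" for k
  proof (induction k)
    case (Suc k)
    have "norm (l - x (Suc k)) \<le> r * (r ^ k * norm (l - x 0))"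
      using step[of k] mult_left_mono[OF Suc assms(1)] by (simp add: norm_minus_commute)
    then show ?case
      by (simp add: norm_minus_commute mult.assoc)
  qed (simp add: norm_minus_commute)
  have "(\<lambda>k. r ^ k * norm (l - x 0)) \<longlonglongrightarrow> 0"
    using assms(1,2) by (intro tendsto_mult_left_zero LIMSEQ_power_zero) simp
  with eventuallyI[OF bound] have "(\<lambda>k. x k - l) \<longlonglongrightarrow> 0"
    by (rule Lim_null_comparison)
  then have "x \<longlonglongrightarrow> l"
    by (rule LIM_zero_cancel)
  then show ?thesis
    using assms by (auto simp: converges_Q_linearly_def)
qed

theorem theorem2:
  fixes T :: "real ^ 'n ^ 'n" and b :: "real ^ 'n"
  assumes "invertible T"
    and "mat_norm (matrix_inv T) < 1"
  shows "(\<forall>x0. newton_well_defined T b x0) \<and>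
    (mat_norm (matrix_inv T) < 1 / 2 \<longrightarrow>
      (\<exists>xs. (\<forall>y. pos_part y + T *v y = b \<longleftrightarrow> y = xs) \<and>
        (\<forall>x0 x. newton_seq T b x0 x \<longrightarrow>
          converges_Q_linearly x xs \<and>
          (\<forall>k. norm (xs - x (Suc k))
             \<le> mat_norm (matrix_inv T) / (1 - mat_norm (matrix_inv T)) * norm (xs - x k)))))"
proof (intro conjI allI impI)
  show "newton_well_defined T b x0" for x0
    by (intro newton_well_definedI invertible_P_add assms)
next
  let ?r = "mat_norm (matrix_inv T) / (1 - mat_norm (matrix_inv T))"
  assume "mat_norm (matrix_inv T) < 1 / 2"
  \<comment> \<open>With \<open>c = mat_norm (matrix_inv T)\<close>, \<open>?r < 1\<close> means
    \<open>c < 1 - c\<close>, which is where the threshold 1/2 comes from.\<close>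
  then have r: "0 \<le> ?r" "?r < 1"
    using mat_norm_nonneg[of "matrix_inv T"] by (simp_all add: field_simps)
  \<comment> \<open>The limit is fixed before any starting point is chosen, so it is common to all
    sequences.\<close>
  obtain xs where xs: "\<And>y. pos_part y + T *v y = b \<longleftrightarrow> y = xs"
    using ex1_pos_part_equation[OF assms] by metis
  have err: "norm (xs - x (Suc k)) \<le> ?r * norm (xs - x k)" if "newton_seq T b x0 x" for x0 x k
    using that xs by (intro newton_error_le[OF assms]) (auto simp: newton_seq_def)
  show "\<exists>xs. (\<forall>y. pos_part y + T *v y = b \<longleftrightarrow> y = xs) \<and>
      (\<forall>x0 x. newton_seq T b x0 x \<longrightarrow> converges_Q_linearly x xs \<and>
        (\<forall>k. norm (xs - x (Suc k)) \<le> ?r * norm (xs - x k)))"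
  proof (intro exI[of _ xs] conjI allI impI xs)
    fix x0 x assume "newton_seq T b x0 x"
    note step = err[OF this]
    show "norm (xs - x (Suc k)) \<le> ?r * norm (xs - x k)" for k
      by (rule step)
    show "converges_Q_linearly x xs"
      using r step by (rule converges_Q_linearlyI)
  qed
qed

end
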